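(* Let $T=(V,E)$ be a finite tree that is not a path or a star, and let its metric $w(t)$ evolve under the Ricci flow $\frac{d}{dt}w_e=-\kappa_e w_e$, $e\in E$, from an initial metric in $\mathbb{R}_{>0}^E$. Let $f$ be an arbitrary internal edge. Then: (ia) $\lim_{t\to\infty}w_f(t)$ exists, is positive, and is possibly infinite; (ib) if $\lim_{t\to\infty}w_f(t)$ is finite, then $\lim_{t\to\infty}\kappa_f(t)=0$; (ii) if $u$ is an endpoint of $f$ that is incident to leaf edges and $e$ is a leaf edge incident to $u$, then $w_e(t)<w_f(t)$ for all sufficiently large $t$.
   Context: Trees are finite and connected; $d_u$ is the degree of $u$. Leaf edge: an edge with an endpoint of degree $1$; all other edges are internal. For a metric $w\in\mathbb{R}_{>0}^{E}$, let $d(x,y)$ be the weighted path distance and $D_x=\sum_{z\sim x}1/w_{xz}$. The curvature is the Lin-Lu-Yau version of Ollivier Ricci curvature with parameter function $\gamma(x)=1/x$: let $\mu_x^\alpha$ be the probability measure with $\mu_x^\alpha(x)=\alpha$, $\mu_x^\alpha(y)=(1-\alpha)\frac{1/w_{xy}}{D_x}$ for $y\sim x$, and $0$ otherwise; with $W$ the $L^1$ transportation distance for $d$, set $\kappa_\alpha(x,y)=1-W(\mu_x^\alpha,\mu_y^\alpha)/d(x,y)$ and $\kappa_{xy}=\lim_{\alpha\to1}\kappa_\alpha(x,y)/(1-\alpha)$. On a tree, for an edge $uv$, $\kappa_{uv}=\frac{2-d_u}{w_{uv}D_u}+\frac{2-d_v}{w_{uv}D_v}$. $\kappa_e(t)$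 is the curvature with respect to $w(t)$. The flow has a unique positive solution for all $t\ge0$. *)

theory Defs
  imports "HOL-Probability.Probability"
begin

section \<open>Finite simple graphs and trees\<close>

text \<open>
  A graph is a vertex set together with a set of edges, an edge being a two-element set of
  vertices. Walks and paths are nonempty vertex lists.
\<close>

definition simple_graph :: "'a set \<Rightarrow> 'a set set \<Rightarrow> bool" where
  "simple_graph V E \<longleftrightarrow> finite V \<and> E \<subseteq> {e. e \<subseteq> V \<and> card e = 2}"

definition graph_path :: "'a set \<Rightarrow> 'a set set \<Rightarrow> 'a \<Rightarrow> 'a list \<Rightarrow> 'a \<Rightarrow> bool" where
  "graph_path V E x p y \<longleftrightarrow>
     p \<noteq> [] \<and> hd p = x \<and> last p = y \<and> distinct p \<and> set p \<subseteq> V \<and>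
     successively (\<lambda>u v. {u, v} \<in> E) p"

definition graph_cycle :: "'a set set \<Rightarrow> 'a list \<Rightarrow> bool" where
  "graph_cycle E p \<longleftrightarrow>
     3 \<le> length p \<and> distinct p \<and> successively (\<lambda>u v. {u, v} \<in> E) p \<and> {last p, hd p} \<in> E"

definition is_tree :: "'a set \<Rightarrow> 'a set set \<Rightarrow> bool" where
  "is_tree V E \<longleftrightarrow>
     simple_graph V E \<and> V \<noteq> {} \<and>
     (\<forall>x\<in>V. \<forall>y\<in>V. \<exists>p. graph_path V E x p y) \<and>
     (\<nexists>p. graph_cycle E p)"

text \<open>A path may consist of a single vertex, and so may a star.\<close>

definition is_path_graph :: "'a set \<Rightarrow> 'a set set \<Rightarrow> bool" where
  "is_path_graph V E \<longleftrightarrow>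
     (\<exists>p. distinct p \<and> set p = V \<and> E = {{p ! i, p ! Suc i} | i. Suc i < length p})"

definition is_star_graph :: "'a set \<Rightarrow> 'a set set \<Rightarrow> bool" where
  "is_star_graph V E \<longleftrightarrow> (\<exists>c\<in>V. E = {{c, v} | v. v \<in> V - {c}})"

definition neighbours :: "'a set set \<Rightarrow> 'a \<Rightarrow> 'a set" where
  "neighbours E x = {z. {x, z} \<in> E}"

definition deg :: "'a set set \<Rightarrow> 'a \<Rightarrow> nat" where
  "deg E x = card (neighbours E x)"

definition leaf_edge :: "'a set set \<Rightarrow> 'a set \<Rightarrow> bool" where
  "leaf_edge E e \<longleftrightarrow> e \<in> E \<and> (\<exists>x\<in>e. deg E x = 1)"

definition internal_edge :: "'a set set \<Rightarrow> 'a set \<Rightarrow> bool" where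
  "internal_edge E e \<longleftrightarrow> e \<in> E \<and> \<not> leaf_edge E e"


section \<open>Metric, transportation distance and curvature\<close>

definition path_weight :: "('a set \<Rightarrow> real) \<Rightarrow> 'a list \<Rightarrow> real" where
  "path_weight w p = (\<Sum>i < length p - 1. w {p ! i, p ! Suc i})"

definition path_dist :: "'a set \<Rightarrow> 'a set set \<Rightarrow> ('a set \<Rightarrow> real) \<Rightarrow> 'a \<Rightarrow> 'a \<Rightarrow> real" where
  "path_dist V E w x y = (INF p\<in>{p. graph_path V E x p y}. path_weight w p)"

definition total_weight :: "'a set set \<Rightarrow> ('a set \<Rightarrow> real) \<Rightarrow> 'a \<Rightarrow> real" where
  "total_weight E w x = (\<Sum>z\<in>neighbours E x. 1 / w {x, z})"

definition lazy_mass :: "'a set set \<Rightarrow> ('a set \<Rightarrow> real) \<Rightarrow> real \<Rightarrow> 'a \<Rightarrow> 'a \<Rightarrow> real" where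
  "lazy_mass E w \<alpha> x y =
     (if y = x then \<alpha>
      else if y \<in> neighbours E x then (1 - \<alpha>) * ((1 / w {x, y}) / total_weight E w x)
      else 0)"

text \<open>
  This is meaningful only when the masses are nonnegative and sum to one; the lemma
  \<open>pmf_lazy_measure\<close> below shows that this is so for \<open>0 \<le> \<alpha> \<le> 1\<close>, positive weights and a
  vertex with at least one neighbour.
\<close>

definition lazy_measure :: "'a set set \<Rightarrow> ('a set \<Rightarrow> real) \<Rightarrow> real \<Rightarrow> 'a \<Rightarrow> 'a pmf" where
  "lazy_measure E w \<alpha> x = embed_pmf (lazy_mass E w \<alpha> x)"

definition couplings :: "'a pmf \<Rightarrow> 'a pmf \<Rightarrow> ('a \<times> 'a) pmf set" where
  "couplings \<mu> \<nu> = {\<pi>. map_pmf fst \<pi> = \<mu> \<and> map_pmf snd \<pi> = \<nu>}"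

definition transport_dist :: "('a \<Rightarrow> 'a \<Rightarrow> real) \<Rightarrow> 'a pmf \<Rightarrow> 'a pmf \<Rightarrow> real" where
  "transport_dist d \<mu> \<nu> =
     (INF \<pi>\<in>couplings \<mu> \<nu>. measure_pmf.expectation \<pi> (\<lambda>(x, y). d x y))"

definition lazy_curvature ::
    "'a set \<Rightarrow> 'a set set \<Rightarrow> ('a set \<Rightarrow> real) \<Rightarrow> real \<Rightarrow> 'a \<Rightarrow> 'a \<Rightarrow> real" where
  "lazy_curvature V E w \<alpha> x y =
     1 - transport_dist (path_dist V E w) (lazy_measure E w \<alpha> x) (lazy_measure E w \<alpha> y)
           / path_dist V E w x y"

text \<open>The limit is one-sided because the lazy measures exist only for \<open>\<alpha> \<le> 1\<close>.\<close>

definition curvature ::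
    "'a set \<Rightarrow> 'a set set \<Rightarrow> ('a set \<Rightarrow> real) \<Rightarrow> 'a \<Rightarrow> 'a \<Rightarrow> real" where
  "curvature V E w x y = Lim (at_left 1) (\<lambda>\<alpha>. lazy_curvature V E w \<alpha> x y / (1 - \<alpha>))"

lemma pmf_lazy_measure:
  assumes V: "simple_graph V E" and pos: "\<And>e. e \<in> E \<Longrightarrow> w e > 0"
    and nb: "neighbours E x \<noteq> {}" and \<alpha>: "0 \<le> \<alpha>" "\<alpha> \<le> 1"
  shows "pmf (lazy_measure E w \<alpha> x) y = lazy_mass E w \<alpha> x y"
proof -
  let ?N = "neighbours E x"
  have sub: "?N \<subseteq> V" and xN: "x \<notin> ?N"
    using V by (auto simp: simple_graph_def neighbours_def)
  have fin: "finite ?N"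
    using V sub by (auto simp: simple_graph_def intro: finite_subset)
  have posN: "1 / w {x, z} > 0" if "z \<in> ?N" for z
    using that pos by (auto simp: neighbours_def)
  have D: "total_weight E w x > 0"
    unfolding total_weight_def using fin nb posN by (intro sum_pos) auto
  have nonneg: "0 \<le> lazy_mass E w \<alpha> x z" for z
    using \<alpha> D posN[of z] by (auto simp: lazy_mass_def)
  have "(\<Sum>z\<in>insert x ?N. lazy_mass E w \<alpha> x z)
      = \<alpha> + (\<Sum>z\<in>?N. (1 - \<alpha>) * ((1 / w {x, z}) / total_weight E w x))"
    using fin xN by (auto simp: lazy_mass_def intro!: sum.cong)
  also have "\<dots> = \<alpha> + (1 - \<alpha>) * ((\<Sum>z\<in>?N. 1 / w {x, z}) / total_weight E w x)"
    by (simp only: sum_distrib_left sum_divide_distrib)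
  also have "\<dots> = 1"
    using D by (simp add: total_weight_def[symmetric])
  finally have total: "(\<Sum>z\<in>insert x ?N. lazy_mass E w \<alpha> x z) = 1" .
  have "(\<integral>\<^sup>+ z. ennreal (lazy_mass E w \<alpha> x z) \<partial>count_space UNIV)
      = (\<Sum>z\<in>insert x ?N. ennreal (lazy_mass E w \<alpha> x z))"
    using fin by (intro nn_integral_count_space') (auto simp: lazy_mass_def)
  also have "\<dots> = 1"
    using nonneg total by (simp only: sum_ennreal ennreal_1)
  finally show ?thesis
    unfolding lazy_measure_def using nonneg by (intro pmf_embed_pmf) auto
qed


section \<open>Ricci flow\<close>

text \<open>
  The initial metric is \<open>w 0\<close>. At time \<open>0\<close> the derivative is one-sided. Both orientations of an
  edge are covered; the curvature is symmetric in its two vertices.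
\<close>

definition ricci_flow :: "'a set \<Rightarrow> 'a set set \<Rightarrow> (real \<Rightarrow> 'a set \<Rightarrow> real) \<Rightarrow> bool" where
  "ricci_flow V E w \<longleftrightarrow>
     (\<forall>t\<ge>0. \<forall>e\<in>E. w t e > 0) \<and>
     (\<forall>t\<ge>0. \<forall>x y. {x, y} \<in> E \<longrightarrow>
        ((\<lambda>s. w s {x, y}) has_real_derivative
           - curvature V E (w t) x y * w t {x, y}) (at t within {0..}))"

end

(*
  Put r_u = (d_u - 2) / D_u. The curvature formula turns the flow into w_{uv}' = r_u + r_v, where
  r_u is nonnegative unless u is a leaf, and r_u = -w_e if u is the end of the leaf edge e. Hence
  internal weights are nondecreasing, which gives (ia). Every edge e at a vertex u that is not a
  leaf satisfies w_e' \<ge> -w_e, so exp t * w_e, and with it exp t * r_u, is nondecreasing; thus w_f'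
  cannot drop quickly, and w_f' tends to 0 when w_f converges, which gives (ib). For (ii),
  (w_f - w_e)' = w_e + r_v, which is bounded below by w_f(0) > 0 as long as w_f \<le> w_e.
*)
theory Submission
  imports Defs
begin

section \<open>Distances in a tree\<close>

text \<open>Induction strips a common first vertex. If the paths separate right after
  \<open>x\<close>, they must meet again because both end at \<open>y\<close>, and the two segments
  between the separation and the first meeting close up into a cycle.\<close>

lemma acyclic_paths_unique:
  assumes ac: "\<nexists>p. graph_cycle E p"
    and "graph_path V E x p y" "graph_path V E x q y"
  shows "p = q"
  using assms(2,3)
proof (induction p arbitrary: x q)
  case Nil
  then show ?case by (simp add: graph_path_def)
next
  case (Cons x' p)
  then have [simp]: "x' = x" by (simp add: graph_path_def)
  from Cons.prems obtain q' where q: "q = x # q'"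
    by (cases q) (auto simp: graph_path_def)
  show ?case
  proof (cases "p = [] \<or> q' = []")
    case True
    then show ?thesis using Cons.prems q
      by (auto simp: graph_path_def split: if_splits)
  next
    case False
    then have ne: "p \<noteq> []" "q' \<noteq> []" by auto
    have gp: "graph_path V E (hd p) p y" "graph_path V E (hd q') q' y"
      and x: "x \<notin> set p" "x \<notin> set q'" "{x, hd p} \<in> E" "{x, hd q'} \<in> E"
      using Cons.prems q ne by (auto simp: graph_path_def successively_Cons)
    show ?thesis
    proof (cases "hd p = hd q'")
      case True
      then show ?thesis using Cons.IH gp q by simp
    next
      case False
      have "\<exists>c\<in>set p. c \<in> set q'"
        using gp ne by (auto simp: graph_path_def intro!: bexI[of _ y] dest: last_in_set)
      then obtain p1 c p2 where p: "p = p1 @ c # p2" "c \<in> set q'" "\<forall>z\<in>set p1. z \<notin> set q'"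
        \<comment> \<open>Taking the first meeting vertex along \<open>p\<close> keeps
          \<open>p1\<close> off \<open>q'\<close>, which makes the cycle below distinct.\<close>
        using split_list_first_prop[of p "\<lambda>c. c \<in> set q'"] by blast
      from p(2) obtain q1 q2 where q': "q' = q1 @ c # q2" by (meson split_list)
      \<comment> \<open>Go out from \<open>x\<close> along \<open>p\<close> as far as
        \<open>c\<close>, then back along \<open>q'\<close> to its first vertex, a neighbour of
        \<open>x\<close>.\<close>
      let ?C = "x # p1 @ c # rev q1"
      have rev: "successively (\<lambda>u v. {u, v} \<in> E) (c # rev q1)"
      proof -
        have "successively (\<lambda>u v. {u, v} \<in> E) (q1 @ [c])"
          using gp(2) q' by (auto simp: graph_path_def successively_append_iff)
        then have "successively (\<lambda>u v. {v, u} \<in> E) (rev (q1 @ [c]))"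
          by (simp only: successively_rev)
        then show ?thesis by (simp add: insert_commute)
      qed
      have "graph_cycle E ?C"
        unfolding graph_cycle_def
      proof (intro conjI)
        \<comment> \<open>If \<open>p1\<close> and \<open>q1\<close> were both empty, then
          \<open>hd p = c = hd q'\<close>.\<close>
        show "3 \<le> length ?C"
          using False p(1) q' by (cases p1; cases q1) auto
        show "distinct ?C"
          using gp x p q' by (auto simp: graph_path_def)
        show "successively (\<lambda>u v. {u, v} \<in> E) ?C"
          using gp(1) x(3) p(1) rev
          by (cases p1) (auto simp: graph_path_def successively_append_iff successively_Cons hd_append)
        show "{last ?C, hd ?C} \<in> E"
          using x(4) q' by (cases q1) (auto simp: insert_commute)
      qed
      then show ?thesis using ac by blast
    qed
  qed
qed

text \<open>Mixture with weights \<open>1 - 2 * p\<close>, \<open>p\<close>, \<open>p\<close>,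
  realised by two successive coin flips so that marginals and expectations follow from the laws for
  \<open>bind_pmf\<close>. It will serve as the optimal transport plan across an edge, with
  \<open>p = 1 - \<alpha>\<close>.\<close>

definition mix3 :: "real \<Rightarrow> 'b pmf \<Rightarrow> 'b pmf \<Rightarrow> 'b pmf \<Rightarrow> 'b pmf" where
  "mix3 p M A B = bind_pmf (bernoulli_pmf (1 - 2 * p))
     (\<lambda>b. if b then M else bind_pmf (bernoulli_pmf (1 / 2)) (\<lambda>c. if c then A else B))"

lemma map_mix3: "map_pmf f (mix3 p M A B) = mix3 p (map_pmf f M) (map_pmf f A) (map_pmf f B)"
  unfolding mix3_def map_bind_pmf
  by (intro bind_pmf_cong refl) (auto simp: map_bind_pmf intro!: bind_pmf_cong)

lemma pmf_mix3:
  assumes "0 \<le> p" "p \<le> 1 / 2"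
  shows "pmf (mix3 p M A B) z = (1 - 2 * p) * pmf M z + p * pmf A z + p * pmf B z"
  using assms by (simp add: mix3_def pmf_bind algebra_simps)

lemma expectation_mix3:
  fixes f :: "'b \<Rightarrow> real"
  assumes p: "0 \<le> p" "p \<le> 1 / 2"
    and fin: "finite (set_pmf M)" "finite (set_pmf A)" "finite (set_pmf B)"
  shows "measure_pmf.expectation (mix3 p M A B) f = (1 - 2 * p) * measure_pmf.expectation M f
    + p * measure_pmf.expectation A f + p * measure_pmf.expectation B f"
proof -
  let ?N = "bind_pmf (bernoulli_pmf (1 / 2)) (\<lambda>c. if c then A else B)"
  have "measure_pmf.expectation ?N f
      = (\<Sum>c\<in>UNIV. pmf (bernoulli_pmf (1 / 2)) c *\<^sub>R measure_pmf.expectation (if c then A else B) f)"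
    by (rule pmf_expectation_bind) (use fin in auto)
  then have N: "measure_pmf.expectation ?N f
      = 1 / 2 * measure_pmf.expectation A f + 1 / 2 * measure_pmf.expectation B f"
    by (simp add: UNIV_bool)
  have "measure_pmf.expectation (mix3 p M A B) f
      = (\<Sum>b\<in>UNIV. pmf (bernoulli_pmf (1 - 2 * p)) b *\<^sub>R
          measure_pmf.expectation (if b then M else ?N) f)"
    unfolding mix3_def by (rule pmf_expectation_bind) (use fin in auto)
  also have "\<dots> = (1 - 2 * p) * measure_pmf.expectation M f
      + 2 * p * measure_pmf.expectation ?N f"
    using p by (simp add: UNIV_bool)
  finally show ?thesis unfolding N by (simp add: algebra_simps)
qed

section \<open>Distances between nearby vertices for a fixed metric\<close>

locale weighted_tree =
  fixes V :: "'a set" and E :: "'a set set" and w :: "'a set \<Rightarrow> real"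
  assumes tree: "is_tree V E" and weight_pos: "e \<in> E \<Longrightarrow> w e > 0"
begin

abbreviation "d \<equiv> path_dist V E w"

lemma simple: "simple_graph V E"
  using tree by (simp add: is_tree_def)

lemma edgeD:
  assumes "{u, v} \<in> E"
  shows "u \<noteq> v" "u \<in> V" "v \<in> V"
proof -
  have "card {u, v} = 2" "{u, v} \<subseteq> V"
    using assms simple by (auto simp: simple_graph_def)
  then show "u \<noteq> v" "u \<in> V" "v \<in> V" by auto
qed

lemma neighbours_iff: "z \<in> neighbours E u \<longleftrightarrow> {u, z} \<in> E"
  by (simp add: neighbours_def)

lemma finite_neighbours: "finite (neighbours E u)"
proof (rule finite_subset)
  show "neighbours E u \<subseteq> V" by (auto simp: neighbours_iff dest: edgeD)
  show "finite V" using simple by (simp add: simple_graph_def)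
qed

text \<open>By uniqueness of paths the infimum runs over a singleton.\<close>

lemma path_dist_eq:
  assumes "graph_path V E x p y"
  shows "d x y = path_weight w p"
proof -
  have "\<nexists>p. graph_cycle E p"
    using tree by (simp add: is_tree_def)
  then have "q = p" if "graph_path V E x q y" for q
    by (rule acyclic_paths_unique[OF _ that assms])
  then have "{p. graph_path V E x p y} = {p}"
    using assms by blast
  then show ?thesis by (simp add: path_dist_def)
qed

lemma path_dist_self: "x \<in> V \<Longrightarrow> d x x = 0"
  by (subst path_dist_eq[of x "[x]"]) (auto simp: graph_path_def path_weight_def)

lemma path_dist_edge: "{x, y} \<in> E \<Longrightarrow> d x y = w {x, y}"
  using edgeD[of x y]
  by (subst path_dist_eq[of x "[x, y]"]) (auto simp: graph_path_def path_weight_def)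

lemma path_dist_2:
  assumes "{x, y} \<in> E" "{y, z} \<in> E" "x \<noteq> z"
  shows "d x z = w {x, y} + w {y, z}"
  using assms edgeD[of x y] edgeD[of y z]
  by (subst path_dist_eq[of x "[x, y, z]"])
    (simp_all add: graph_path_def path_weight_def numeral_2_eq_2)

lemma path_dist_3:
  assumes "{a, b} \<in> E" "{b, c} \<in> E" "{c, e} \<in> E" "a \<noteq> c" "b \<noteq> e"
  shows "d a e = w {a, b} + w {b, c} + w {c, e}"
proof -
  note e = edgeD[OF assms(1)] edgeD[OF assms(2)] edgeD[OF assms(3)]
  \<comment> \<open>If \<open>a = e\<close>, the three edges would form a triangle.\<close>
  have "\<not> graph_cycle E [a, b, c]"
    using tree by (simp add: is_tree_def)
  then have "a \<noteq> e"
    using assms e by (auto simp: graph_cycle_def)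
  then show ?thesis
    using assms e by (subst path_dist_eq[of a "[a, b, c, e]"])
      (simp_all add: graph_path_def path_weight_def numeral_3_eq_3)
qed

text \<open>
  This inequality makes \<open>a \<mapsto> d a v\<close> and \<open>b \<mapsto> d u b - w {u, v}\<close> a dual feasible pair for
  the transport problem between two random walk steps across \<open>uv\<close>.
\<close>

lemma path_dist_across_edge:
  assumes uv: "{u, v} \<in> E"
    and a: "a \<in> insert u (neighbours E u)" and b: "b \<in> insert v (neighbours E v)"
  shows "d a v + d u b \<le> d a b + w {u, v}"
proof -
  note uvD = edgeD[OF uv]
  have vu: "{v, u} \<in> E" "w {v, u} = w {u, v}" using uv by (simp_all add: insert_commute)
  \<comment> \<open>Equality holds in every case except \<open>a = v\<close>, \<open>b = u\<close>,
    where the left side is \<open>0\<close> and the right side is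
    \<open>2 * w {u, v}\<close>.\<close>
  consider "a = u" | "b = v" | "a = v" "b = u"
    | "a = v" "b \<noteq> u" "{v, b} \<in> E" | "b = u" "a \<noteq> v" "{a, u} \<in> E"
    | "a \<noteq> v" "b \<noteq> u" "{a, u} \<in> E" "{v, b} \<in> E"
    using a b by (auto simp: neighbours_iff insert_commute)
  then show ?thesis
  proof cases
    case 1
    then show ?thesis using uv uvD by (simp add: path_dist_self path_dist_edge)
  next
    case 2
    then show ?thesis using uv uvD by (simp add: path_dist_self path_dist_edge)
  next
    case 3
    then show ?thesis
      using uvD vu path_dist_edge[OF vu(1)] weight_pos[OF uv] by (simp add: path_dist_self)
  next
    case 4
    then show ?thesis
      using uvD path_dist_edge[of v b] path_dist_2[OF uv, of b] by (simp add: path_dist_self)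
  next
    case 5
    then show ?thesis
      using uvD path_dist_edge[of a u] path_dist_2[of a u v] uv by (simp add: path_dist_self)
  next
    case 6
    then show ?thesis
      using uv path_dist_2[of a u v] path_dist_2[of u v b] path_dist_3[of a u v b] by simp
  qed
qed


section \<open>Curvature of an edge\<close>

lemma total_weight_pos:
  assumes "neighbours E u \<noteq> {}"
  shows "total_weight E w u > 0"
  unfolding total_weight_def
  using finite_neighbours assms weight_pos by (intro sum_pos) (auto simp: neighbours_iff)

lemma set_lazy_measure:
  assumes "neighbours E u \<noteq> {}" "0 \<le> \<alpha>" "\<alpha> \<le> 1"
  shows "set_pmf (lazy_measure E w \<alpha> u) \<subseteq> insert u (neighbours E u)"
proof
  fix z assume "z \<in> set_pmf (lazy_measure E w \<alpha> u)"
  then have "lazy_mass E w \<alpha> u z \<noteq> 0"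
    using assms weight_pos by (simp add: set_pmf_iff pmf_lazy_measure[OF simple])
  then show "z \<in> insert u (neighbours E u)"
    by (auto simp: lazy_mass_def split: if_splits)
qed

lemma expectation_lazy_measure:
  assumes "neighbours E u \<noteq> {}" "0 \<le> \<alpha>" "\<alpha> \<le> 1"
  shows "measure_pmf.expectation (lazy_measure E w \<alpha> u) f =
    \<alpha> * f u + (1 - \<alpha>) * (\<Sum>z\<in>neighbours E u. 1 / w {u, z} / total_weight E w u * f z)"
proof -
  have u: "u \<notin> neighbours E u" using edgeD[of u u] by (auto simp: neighbours_iff)
  have "measure_pmf.expectation (lazy_measure E w \<alpha> u) f
      = (\<Sum>z\<in>insert u (neighbours E u). f z * pmf (lazy_measure E w \<alpha> u) z)"
    using set_lazy_measure[OF assms] finite_neighbours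
    by (intro integral_measure_pmf_real) auto
  also have "\<dots> = (\<Sum>z\<in>insert u (neighbours E u). f z * lazy_mass E w \<alpha> u z)"
    using assms weight_pos by (simp add: pmf_lazy_measure[OF simple])
  also have "\<dots> = \<alpha> * f u + (\<Sum>z\<in>neighbours E u. f z * lazy_mass E w \<alpha> u z)"
    using finite_neighbours u by (simp add: lazy_mass_def)
  also have "(\<Sum>z\<in>neighbours E u. f z * lazy_mass E w \<alpha> u z) =
      (\<Sum>z\<in>neighbours E u. (1 - \<alpha>) * (1 / w {u, z} / total_weight E w u * f z))"
    using u by (intro sum.cong) (auto simp: lazy_mass_def)
  finally show ?thesis by (simp add: sum_distrib_left)
qed

text \<open>A neighbour \<open>z\<close> other than \<open>v\<close> is at distance
  \<open>w {u, z} + w {u, v}\<close> from \<open>v\<close>; its probability cancels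
  \<open>w {u, z}\<close> and leaves \<open>1 / D\<close> with
  \<open>D = total_weight E w u\<close>. The same expression at \<open>z = v\<close> would be
  \<open>2 * w {u, v}\<close> instead of \<open>0\<close>, and removing it subtracts
  \<open>2 / D\<close>.\<close>

lemma mean_dist_across_edge:
  assumes uv: "{u, v} \<in> E"
  shows "(\<Sum>z\<in>neighbours E u. 1 / w {u, z} / total_weight E w u * d z v) =
    w {u, v} + (real (deg E u) - 2) / total_weight E w u"
proof -
  let ?N = "neighbours E u" and ?D = "total_weight E w u" and ?w = "w {u, v}"
  have v: "v \<in> ?N" using uv by (simp add: neighbours_iff)
  then have D: "?D > 0" by (intro total_weight_pos) auto
  have dist: "d z v = (w {u, z} + ?w) - (if z = v then 2 * ?w else 0)" if "z \<in> ?N" for z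
    using that uv edgeD[OF uv]
    by (auto simp: neighbours_iff path_dist_self path_dist_2[of z u v] insert_commute)
  have "(\<Sum>z\<in>?N. 1 / w {u, z} / ?D * d z v) =
      (\<Sum>z\<in>?N. 1 / ?D + ?w / ?D * (1 / w {u, z}) - (if z = v then 2 / ?D else 0))"
  proof (rule sum.cong)
    fix z assume z: "z \<in> ?N"
    then have "w {u, z} > 0" by (simp add: neighbours_iff weight_pos)
    then show "1 / w {u, z} / ?D * d z v =
        1 / ?D + ?w / ?D * (1 / w {u, z}) - (if z = v then 2 / ?D else 0)"
      using D by (simp add: dist[OF z] field_simps)
  qed simp
  also have "\<dots> = real (card ?N) / ?D + ?w / ?D * ?D - 2 / ?D"
  proof -
    have "(\<Sum>z\<in>?N. ?w / ?D * (1 / w {u, z})) = ?w / ?D * ?D"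
      by (simp only: sum_distrib_left[symmetric] total_weight_def[symmetric])
    then show ?thesis
      using finite_neighbours v by (simp only: sum.distrib sum_subtractf sum.delta sum_constant) simp
  qed
  also have "\<dots> = ?w + (real (deg E u) - 2) / ?D"
    using D by (simp add: deg_def diff_divide_distrib)
  finally show ?thesis .
qed

text \<open>
  An optimal plan moves \<open>u\<close> to \<open>v\<close> with probability \<open>2\<alpha> - 1\<close>, and otherwise, with equal
  probability, moves a random walk step from \<open>u\<close> to \<open>v\<close>, or \<open>u\<close> to a random walk step from \<open>v\<close>.
\<close>

lemma transport_dist_edge:
  assumes uv: "{u, v} \<in> E" and \<alpha>: "1 / 2 \<le> \<alpha>" "\<alpha> \<le> 1"
  shows "transport_dist d (lazy_measure E w \<alpha> u) (lazy_measure E w \<alpha> v) =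
    w {u, v} + (1 - \<alpha>) * ((real (deg E u) - 2) / total_weight E w u
                         + (real (deg E v) - 2) / total_weight E w v)"
    (is "transport_dist d ?\<mu> ?\<nu> = ?W")
proof -
  let ?w = "w {u, v}"
  have vu: "{v, u} \<in> E" "w {v, u} = ?w" using uv by (simp_all add: insert_commute)
  have N: "neighbours E u \<noteq> {}" "neighbours E v \<noteq> {}"
    using uv vu by (auto simp: neighbours_iff)
  have \<alpha>0: "0 \<le> \<alpha>" using \<alpha> by simp
  \<comment> \<open>\<open>A\<close> is the mean distance to \<open>v\<close> after a walk step from
    \<open>u\<close>, and \<open>B\<close> the mean distance from \<open>u\<close> to a walk step
    from \<open>v\<close>.\<close>
  define A where "A = ?w + (real (deg E u) - 2) / total_weight E w u"
  define B where "B = ?w + (real (deg E v) - 2) / total_weight E w v"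
  have B: "(\<Sum>z\<in>neighbours E v. 1 / w {v, z} / total_weight E w v * d u z) = B"
  proof -
    have "d u z = d z u" if "z \<in> neighbours E v" for z
      using that uv vu edgeD[OF uv]
      by (cases "z = u")
        (auto simp: neighbours_iff path_dist_2[of u v z] path_dist_2[of z v u] insert_commute)
    then show ?thesis
      using mean_dist_across_edge[OF vu(1)] vu(2) by (simp add: B_def)
  qed
  \<comment> \<open>The laziness \<open>\<beta>\<close> stays free: the lower bound uses
    \<open>\<beta> = \<alpha>\<close>, the plan uses \<open>\<beta> = 0\<close>, a pure walk
    step.\<close>
  have Ex\<mu>: "measure_pmf.expectation (lazy_measure E w \<beta> u) (\<lambda>a. d a v) = \<beta> * ?w + (1 - \<beta>) * A"
    if "0 \<le> \<beta>" "\<beta> \<le> 1" for \<beta>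
    unfolding expectation_lazy_measure[OF N(1) that] mean_dist_across_edge[OF uv]
    path_dist_edge[OF uv] A_def ..
  have Ex\<nu>: "measure_pmf.expectation (lazy_measure E w \<beta> v) (\<lambda>b. d u b) = \<beta> * ?w + (1 - \<beta>) * B"
    if "0 \<le> \<beta>" "\<beta> \<le> 1" for \<beta>
    unfolding expectation_lazy_measure[OF N(2) that] B path_dist_edge[OF uv] ..
  have W: "?W = (1 - \<alpha>) * (A + B) + (2 * \<alpha> - 1) * ?w"
    by (simp add: A_def B_def algebra_simps)
  \<comment> \<open>Weak duality: the inequality of \<open>path_dist_across_edge\<close> holds on
    the support of any coupling, and integrating it involves only the two marginals.\<close>
  have lower: "?W \<le> measure_pmf.expectation \<pi> (\<lambda>(x, y). d x y)"
    if \<pi>: "\<pi> \<in> couplings ?\<mu> ?\<nu>" for \<pi>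
  proof -
    have m: "map_pmf fst \<pi> = ?\<mu>" "map_pmf snd \<pi> = ?\<nu>"
      using \<pi> by (auto simp: couplings_def)
    have supp: "a \<in> insert u (neighbours E u)" "b \<in> insert v (neighbours E v)"
      if "(a, b) \<in> set_pmf \<pi>" for a b
    proof -
      have "a \<in> set_pmf (map_pmf fst \<pi>)" "b \<in> set_pmf (map_pmf snd \<pi>)"
        using that unfolding set_map_pmf by force+
      then show "a \<in> insert u (neighbours E u)" "b \<in> insert v (neighbours E v)"
        unfolding m using set_lazy_measure[OF _ \<alpha>0 \<alpha>(2)] N by blast+
    qed
    have fin: "finite (set_pmf \<pi>)"
    proof (rule finite_subset)
      show "set_pmf \<pi> \<subseteq> insert u (neighbours E u) \<times> insert v (neighbours E v)"
        using supp by (intro subrelI SigmaI)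
      show "finite (insert u (neighbours E u) \<times> insert v (neighbours E v))"
        using finite_neighbours by (intro finite_cartesian_product finite.insertI)
    qed
    have int: "integrable (measure_pmf \<pi>) g" for g :: "'a \<times> 'a \<Rightarrow> real"
      using fin by (rule integrable_measure_pmf_finite)
    have "?W = measure_pmf.expectation ?\<mu> (\<lambda>a. d a v)
        + measure_pmf.expectation ?\<nu> (\<lambda>b. d u b) - ?w"
      using Ex\<mu>[OF \<alpha>0 \<alpha>(2)] Ex\<nu>[OF \<alpha>0 \<alpha>(2)] W by (simp add: algebra_simps)
    also have "\<dots> = measure_pmf.expectation \<pi> (\<lambda>p. d (fst p) v + d u (snd p) - ?w)"
      unfolding m[symmetric] integral_map_pmf using int by simp
    also have "\<dots> \<le> measure_pmf.expectation \<pi> (\<lambda>(x, y). d x y)"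
    proof (intro integral_mono_AE int)
      show "AE p in \<pi>. d (fst p) v + d u (snd p) - ?w \<le> (case p of (x, y) \<Rightarrow> d x y)"
      proof (rule AE_pmfI)
        fix p assume p: "p \<in> set_pmf \<pi>"
        obtain a b where [simp]: "p = (a, b)" by (cases p)
        have ab: "(a, b) \<in> set_pmf \<pi>" using p by simp
        show "d (fst p) v + d u (snd p) - ?w \<le> (case p of (x, y) \<Rightarrow> d x y)"
          using path_dist_across_edge[OF uv supp(1)[OF ab] supp(2)[OF ab]] by simp
      qed
    qed
    finally show ?thesis .
  qed
  let ?P = "lazy_measure E w 0 u" and ?Q = "lazy_measure E w 0 v"
  define \<sigma> where "\<sigma> = mix3 (1 - \<alpha>) (return_pmf (u, v))
    (map_pmf (\<lambda>a. (a, v)) ?P) (map_pmf (\<lambda>b. (u, b)) ?Q)"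
  \<comment> \<open>The bound \<open>1 / 2 \<le> \<alpha>\<close> makes the weight
    \<open>2 * \<alpha> - 1\<close> of the direct move nonnegative.\<close>
  have p: "0 \<le> 1 - \<alpha>" "1 - \<alpha> \<le> 1 / 2" using \<alpha> by simp_all
  have pmf_lazy: "pmf (lazy_measure E w \<alpha> s) z
      = \<alpha> * pmf (return_pmf s) z + (1 - \<alpha>) * pmf (lazy_measure E w 0 s) z"
    if "neighbours E s \<noteq> {}" for s z
    using that weight_pos \<alpha>0 \<alpha>(2)
    by (simp add: pmf_lazy_measure[OF simple] lazy_mass_def pmf_return)
  \<comment> \<open>In the first coordinate, \<open>u\<close> keeps mass
    \<open>(2 * \<alpha> - 1) + (1 - \<alpha>) = \<alpha>\<close> and the walk step gets
    \<open>1 - \<alpha>\<close>; the second coordinate is analogous.\<close>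
  have \<sigma>: "\<sigma> \<in> couplings ?\<mu> ?\<nu>"
    unfolding couplings_def
  proof (intro CollectI conjI pmf_eqI)
    fix z
    have "map_pmf fst \<sigma> = mix3 (1 - \<alpha>) (return_pmf u) ?P (return_pmf u)"
      by (simp add: \<sigma>_def map_mix3 map_pmf_comp)
    then show "pmf (map_pmf fst \<sigma>) z = pmf ?\<mu> z"
      by (simp add: pmf_mix3[OF p] pmf_lazy[OF N(1)] algebra_simps)
    have "map_pmf snd \<sigma> = mix3 (1 - \<alpha>) (return_pmf v) (return_pmf v) ?Q"
      by (simp add: \<sigma>_def map_mix3 map_pmf_comp)
    then show "pmf (map_pmf snd \<sigma>) z = pmf ?\<nu> z"
      by (simp add: pmf_mix3[OF p] pmf_lazy[OF N(2)] algebra_simps)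
  qed
  have fin: "finite (set_pmf ?P)" "finite (set_pmf ?Q)"
    using set_lazy_measure[of u 0] set_lazy_measure[of v 0] N finite_neighbours
    by (auto intro: finite_subset)
  have "measure_pmf.expectation \<sigma> (\<lambda>(x, y). d x y)
      = (1 - 2 * (1 - \<alpha>)) * d u v + (1 - \<alpha>) * measure_pmf.expectation ?P (\<lambda>a. d a v)
        + (1 - \<alpha>) * measure_pmf.expectation ?Q (\<lambda>b. d u b)"
    unfolding \<sigma>_def using fin by (subst expectation_mix3[OF p]) simp_all
  also have "\<dots> = ?W"
    using Ex\<mu>[of 0] Ex\<nu>[of 0] path_dist_edge[OF uv] unfolding W by (simp add: algebra_simps)
  finally have "measure_pmf.expectation \<sigma> (\<lambda>(x, y). d x y) = ?W" .
  then show ?thesis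
    unfolding transport_dist_def using \<sigma> lower
    by (intro cInf_eq_minimum) (auto intro!: image_eqI[of _ _ \<sigma>])
qed

text \<open>The transport cost is affine in \<open>1 - \<alpha>\<close> on
  \<open>1 / 2 \<le> \<alpha> \<le> 1\<close>, so the quotient defining the curvature is constant
  near \<open>1\<close>. The product with the weight is exactly the right-hand side of the
  flow.\<close>

lemma curvature_edge:
  assumes uv: "{u, v} \<in> E"
  shows "- curvature V E w u v * w {u, v} =
    (real (deg E u) - 2) / total_weight E w u + (real (deg E v) - 2) / total_weight E w v"
    (is "_ = ?c")
proof -
  have w: "w {u, v} > 0" using weight_pos uv .
  have alg: "- c / W = (1 - (W + (1 - \<alpha>) * c) / W) / (1 - \<alpha>)"
    if "W > 0" "\<alpha> < 1" for W c \<alpha> :: real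
    using that by (simp add: field_simps)
  have "\<forall>\<^sub>F \<alpha> in at_left 1. - ?c / w {u, v} = lazy_curvature V E w \<alpha> u v / (1 - \<alpha>)"
    using eventually_at_left_real[of "1/2" 1]
  proof (rule eventually_mono)
    fix \<alpha> :: real assume "\<alpha> \<in> {1/2<..<1}"
    then show "- ?c / w {u, v} = lazy_curvature V E w \<alpha> u v / (1 - \<alpha>)"
      using alg[OF w, of \<alpha> ?c]
      by (simp add: lazy_curvature_def transport_dist_edge[OF uv] path_dist_edge[OF uv])
  qed simp
  then have "((\<lambda>\<alpha>. lazy_curvature V E w \<alpha> u v / (1 - \<alpha>)) \<longlongrightarrow> - ?c / w {u, v}) (at_left 1)"
    by (rule tendsto_eventually[OF eventually_mono]) simp
  then have "curvature V E w u v = - ?c / w {u, v}"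
    unfolding curvature_def by (intro tendsto_Lim) auto
  then show ?thesis using w by simp
qed

end

section \<open>Long-time behaviour of the flow\<close>

text \<open>The flow supplies only a one-sided derivative at \<open>0\<close>; restricting it to
  \<open>{a..b}\<close> still suffices for the mean value theorem.\<close>

lemma half_line_mvt:
  fixes f f' :: "real \<Rightarrow> real"
  assumes "\<And>t. t \<ge> 0 \<Longrightarrow> (f has_real_derivative f' t) (at t within {0..})" "0 \<le> a" "a < b"
  obtains \<xi> where "a < \<xi>" "\<xi> < b" "f b - f a = f' \<xi> * (b - a)"
proof -
  have "(f has_derivative (*) (f' t)) (at t within {a..b})" if "t \<in> {a..b}" for t
    using assms(1)[of t] that \<open>0 \<le> a\<close>
    by (auto simp: has_field_derivative_def intro: has_derivative_subset)
  then show ?thesis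
    using mvt_simple[OF \<open>a < b\<close>, of f "\<lambda>t. (*) (f' t)"] that by auto
qed

lemma half_line_mono:
  fixes f f' :: "real \<Rightarrow> real"
  assumes f: "\<And>t. t \<ge> 0 \<Longrightarrow> (f has_real_derivative f' t) (at t within {0..})"
    and nonneg: "\<And>t. t \<ge> 0 \<Longrightarrow> f' t \<ge> 0" and ab: "0 \<le> a" "a \<le> b"
  shows "f a \<le> f b"
proof (cases "a = b")
  case False
  then have "a < b" using ab by simp
  then obtain \<xi> where "a < \<xi>" "f b - f a = f' \<xi> * (b - a)"
    using half_line_mvt[OF f ab(1)] by metis
  moreover have "f' \<xi> * (b - a) \<ge> 0"
    using \<open>a < \<xi>\<close> ab by (intro mult_nonneg_nonneg nonneg) auto
  ultimately show ?thesis by simp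
qed simp

text \<open>The quantity \<open>r_u\<close>: the contribution of \<open>u\<close> to the speed of an
  edge at \<open>u\<close>, the same for all those edges.\<close>

definition drift :: "'a set set \<Rightarrow> ('a set \<Rightarrow> real) \<Rightarrow> 'a \<Rightarrow> real" where
  "drift E w u = (real (deg E u) - 2) / total_weight E w u"

section \<open>Drift bounds and exponential monotonicity along the flow\<close>

locale tree_flow =
  fixes V :: "'a set" and E :: "'a set set" and w :: "real \<Rightarrow> 'a set \<Rightarrow> real"
  assumes tree: "is_tree V E" and flow: "ricci_flow V E w"
begin

lemma pos: "t \<ge> 0 \<Longrightarrow> e \<in> E \<Longrightarrow> w t e > 0"
  using flow by (simp add: ricci_flow_def)

lemma weighted_tree: "t \<ge> 0 \<Longrightarrow> weighted_tree V E (w t)"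
  using tree pos by unfold_locales auto

lemma weight_deriv:
  assumes "{u, v} \<in> E" "t \<ge> 0"
  shows "((\<lambda>s. w s {u, v}) has_real_derivative drift E (w t) u + drift E (w t) v) (at t within {0..})"
proof -
  interpret weighted_tree V E "w t" using assms(2) by (rule weighted_tree)
  show ?thesis
    using flow assms unfolding ricci_flow_def drift_def curvature_edge[OF assms(1), symmetric]
    by blast
qed

lemma deg_pos:
  assumes "{u, v} \<in> E"
  shows "deg E u > 0"
proof -
  interpret weighted_tree V E "w 0" by (rule weighted_tree) simp
  show ?thesis
    using assms finite_neighbours[of u] by (auto simp: deg_def card_gt_0_iff neighbours_iff)
qed

lemma drift_nonneg:
  assumes "deg E u \<ge> 2" "t \<ge> 0"
  shows "drift E (w t) u \<ge> 0"
proof -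
  interpret weighted_tree V E "w t" using assms(2) by (rule weighted_tree)
  have "neighbours E u \<noteq> {}" using assms(1) by (auto simp: deg_def)
  then show ?thesis
    using total_weight_pos[of u] assms(1) by (simp add: drift_def)
qed

text \<open>With a single neighbour the total weight is \<open>1 / w t {u, v}\<close>, and the
  numerator is \<open>1 - 2\<close>.\<close>

lemma drift_leaf:
  assumes "{u, v} \<in> E" "deg E u = 1"
  shows "drift E (w t) u = - w t {u, v}"
proof -
  have "neighbours E u = {v}"
  proof -
    obtain a where "neighbours E u = {a}"
      using assms(2) by (auto simp: deg_def card_1_singleton_iff)
    moreover have "v \<in> neighbours E u" using assms(1) by (simp add: neighbours_def)
    ultimately show ?thesis by simp
  qed
  then show ?thesis using assms(2) by (simp add: drift_def total_weight_def)
qed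

lemma drift_ge:
  assumes "{u, v} \<in> E" "t \<ge> 0"
  shows "drift E (w t) u \<ge> - w t {u, v}"
proof (cases "deg E u = 1")
  case True
  then show ?thesis using drift_leaf[OF assms(1)] by simp
next
  case False
  then have "deg E u \<ge> 2" using deg_pos[OF assms(1)] by linarith
  then show ?thesis using drift_nonneg[OF _ assms(2)] pos[OF assms(2,1)] by force
qed

text \<open>The end \<open>u\<close> contributes a nonnegative drift, and \<open>z\<close>, even if
  it is a leaf, at least \<open>- w r {u, z}\<close>; the factor \<open>exp r\<close> compensates
  for this loss.\<close>

lemma exp_weight_mono:
  assumes e: "{u, z} \<in> E" and u: "deg E u \<ge> 2" and t: "0 \<le> s" "s \<le> t"
  shows "exp s * w s {u, z} \<le> exp t * w t {u, z}"
proof (rule half_line_mono[OF _ _ t])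
  fix r :: real assume r: "r \<ge> 0"
  let ?c = "drift E (w r) u + drift E (w r) z"
  show "((\<lambda>r. exp r * w r {u, z}) has_real_derivative exp r * (w r {u, z} + ?c)) (at r within {0..})"
    by (rule derivative_eq_intros weight_deriv e r refl)+ (simp add: algebra_simps)
  have "drift E (w r) z \<ge> - w r {u, z}"
    using drift_ge[of z u r] e r by (simp add: insert_commute)
  then show "exp r * (w r {u, z} + ?c) \<ge> 0"
    using drift_nonneg[OF u r] by simp
qed

text \<open>By \<open>exp_weight_mono\<close> each reciprocal weight at \<open>u\<close> grows at
  most by the factor \<open>exp (t - s)\<close> from \<open>s\<close> to \<open>t\<close>, hence so
  does their sum, the denominator of the drift.\<close>

lemma exp_drift_mono:
  assumes u: "deg E u \<ge> 2" and t: "0 \<le> s" "s \<le> t"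
  shows "exp s * drift E (w s) u \<le> exp t * drift E (w t) u"
proof -
  interpret s: weighted_tree V E "w s" using t by (intro weighted_tree) simp
  interpret t: weighted_tree V E "w t" using t by (intro weighted_tree) simp
  have N: "neighbours E u \<noteq> {}" using u by (auto simp: deg_def)
  note D = s.total_weight_pos[OF N] t.total_weight_pos[OF N]
  have "exp s * total_weight E (w t) u \<le> exp t * total_weight E (w s) u"
    unfolding total_weight_def sum_distrib_left
  proof (rule sum_mono)
    fix z assume "z \<in> neighbours E u"
    then have e: "{u, z} \<in> E" by (simp add: neighbours_def)
    then show "exp s * (1 / w t {u, z}) \<le> exp t * (1 / w s {u, z})"
      using exp_weight_mono[OF e u t] s.weight_pos[OF e] t.weight_pos[OF e]
      by (simp add: field_simps)
  qed
  then have "exp s / total_weight E (w s) u \<le> exp t / total_weight E (w t) u"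
    using D by (simp add: field_simps)
  then have "(real (deg E u) - 2) * (exp s / total_weight E (w s) u)
      \<le> (real (deg E u) - 2) * (exp t / total_weight E (w t) u)"
    using u by (intro mult_left_mono) auto
  then show ?thesis by (simp add: drift_def mult.commute)
qed

section \<open>Asymptotics of an edge whose two ends are not leaves\<close>

context
  fixes x y :: 'a
  assumes edge: "{x, y} \<in> E" and deg: "deg E x \<ge> 2" "deg E y \<ge> 2"
begin

lemma internal_weight_mono: "0 \<le> s \<Longrightarrow> s \<le> t \<Longrightarrow> w s {x, y} \<le> w t {x, y}"
  by (rule half_line_mono[OF weight_deriv[OF edge]]) (auto simp: drift_nonneg deg)

text \<open>A nondecreasing function tends to its supremum in the extended reals, here at least the
  positive initial weight.\<close>

lemma internal_weight_limit: "\<exists>L::ereal. 0 < L \<and> ((\<lambda>t. ereal (w t {x, y})) \<longlongrightarrow> L) at_top"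
proof (intro exI conjI)
  let ?L = "SUP t\<in>{0..}. ereal (w t {x, y})"
  have "ereal (w 0 {x, y}) \<le> ?L" by (intro SUP_upper) auto
  moreover have "0 < ereal (w 0 {x, y})" using pos[OF _ edge] by simp
  ultimately show "0 < ?L" by (rule less_le_trans[rotated])
  show "((\<lambda>t. ereal (w t {x, y})) \<longlongrightarrow> ?L) at_top"
  proof (rule increasing_tendsto)
    show "\<forall>\<^sub>F t in at_top. ereal (w t {x, y}) \<le> ?L"
      using eventually_ge_at_top[of 0] by eventually_elim (auto intro: SUP_upper)
    fix b assume "b < ?L"
    then obtain s where s: "0 \<le> s" "b < ereal (w s {x, y})" by (auto simp: less_SUP_iff)
    show "\<forall>\<^sub>F t in at_top. b < ereal (w t {x, y})"
      using eventually_ge_at_top[of s]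
    proof eventually_elim
      case (elim t)
      then have "ereal (w s {x, y}) \<le> ereal (w t {x, y})"
        using internal_weight_mono[OF s(1)] by simp
      then show ?case using s(2) by (rule less_le_trans[rotated])
    qed
  qed
qed

text \<open>
  The derivative of \<open>w t {x, y}\<close> loses at most a factor \<open>exp 1\<close> over a unit of time, so it is
  controlled by the increment of \<open>w\<close> over that time, which tends to \<open>0\<close>.
\<close>

lemma internal_curvature_tendsto_0:
  assumes l: "((\<lambda>t. w t {x, y}) \<longlongrightarrow> l) at_top"
  shows "((\<lambda>t. curvature V E (w t) x y) \<longlongrightarrow> 0) at_top"
proof -
  define c where "c t = drift E (w t) x + drift E (w t) y" for t
  have c0: "c t \<ge> 0" if "t \<ge> 0" for t
    using drift_nonneg deg that by (simp add: c_def)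
  have c1: "c t \<le> exp 1 * (w (t + 1) {x, y} - w t {x, y})" if t: "t \<ge> 0" for t
  proof -
    obtain \<xi> where \<xi>: "t < \<xi>" "\<xi> < t + 1" "w (t + 1) {x, y} - w t {x, y} = c \<xi>"
      using half_line_mvt[OF weight_deriv[OF edge] t, of "t + 1"] by (auto simp: c_def)
    \<comment> \<open>Since \<open>t < \<xi> < t + 1\<close>, cancelling \<open>exp t\<close> leaves
      the factor \<open>exp 1\<close>.\<close>
    have "exp t * c t \<le> exp \<xi> * c \<xi>"
      using exp_drift_mono[OF deg(1) t, of \<xi>] exp_drift_mono[OF deg(2) t, of \<xi>] \<xi>(1)
      by (simp add: c_def distrib_left)
    also have "\<dots> \<le> exp (t + 1) * c \<xi>"
      using \<xi> t c0 by (intro mult_right_mono) auto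
    finally show ?thesis by (simp add: \<xi>(3) exp_add mult.assoc)
  qed
  have "((\<lambda>t. w (t + 1) {x, y}) \<longlongrightarrow> l) at_top"
    by (rule filterlim_compose[OF l])
      (rule filterlim_at_top_mono[OF filterlim_ident], simp)
  then have "((\<lambda>t. exp 1 * (w (t + 1) {x, y} - w t {x, y})) \<longlongrightarrow> exp 1 * (l - l)) at_top"
    by (intro tendsto_intros l)
  then have lim: "((\<lambda>t. exp 1 * (w (t + 1) {x, y} - w t {x, y})) \<longlongrightarrow> 0) at_top"
    by simp
  have "\<forall>\<^sub>F t in at_top. 0 \<le> c t"
    "\<forall>\<^sub>F t in at_top. c t \<le> exp 1 * (w (t + 1) {x, y} - w t {x, y})"
    using c0 c1 by (blast intro: eventually_mono[OF eventually_ge_at_top[of 0]])+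
  then have "(c \<longlongrightarrow> 0) at_top"
    by (rule tendsto_sandwich[OF _ _ tendsto_const lim])
  \<comment> \<open>The curvature is \<open>- c t / w t {x, y}\<close>, so the limit of the
    denominator must not vanish.\<close>
  moreover have "l \<noteq> 0"
  proof -
    have "w 0 {x, y} \<le> l"
    proof (rule tendsto_lowerbound[OF l])
      show "\<forall>\<^sub>F t in at_top. w 0 {x, y} \<le> w t {x, y}"
        using eventually_ge_at_top[of 0] by eventually_elim (rule internal_weight_mono[OF order_refl])
    qed simp
    then show ?thesis using pos[OF _ edge, of 0] by simp
  qed
  ultimately have "((\<lambda>t. - c t / w t {x, y}) \<longlongrightarrow> - 0 / l) at_top"
    by (intro tendsto_intros l)
  moreover have "\<forall>\<^sub>F t in at_top. - c t / w t {x, y} = curvature V E (w t) x y"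
    using eventually_ge_at_top[of 0]
  proof eventually_elim
    case (elim t)
    then interpret weighted_tree V E "w t" by (rule weighted_tree)
    show ?case
      using curvature_edge[OF edge] weight_pos[OF edge] by (simp add: c_def drift_def field_simps)
  qed
  ultimately show ?thesis by (simp add: tendsto_cong)
qed

text \<open>
  The difference \<open>w t {x, y} - w t {x, l}\<close> grows at rate at least \<open>w t {x, l}\<close>, and this rate is
  bounded below as long as the difference is not positive.
\<close>

lemma leaf_weight_less_internal:
  assumes leaf: "{x, l} \<in> E" "deg E l = 1"
  shows "\<forall>\<^sub>F t in at_top. w t {x, l} < w t {x, y}"
proof -
  define g where "g t = w t {x, y} - w t {x, l}" for t
  \<comment> \<open>In the derivative of \<open>g\<close> the drift of the shared vertex
    \<open>x\<close> cancels, and the drift \<open>- w t {x, l}\<close> of the leaf enters with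
    reversed sign.\<close>
  define g' where "g' t = drift E (w t) y + w t {x, l}" for t
  have g: "(g has_real_derivative g' t) (at t within {0..})" if "t \<ge> 0" for t
  proof -
    have "drift E (w t) l = - w t {x, l}"
      using drift_leaf[of l x t] leaf by (simp add: insert_commute)
    then show ?thesis
      using DERIV_diff[OF weight_deriv[OF edge that] weight_deriv[OF leaf(1) that]]
      unfolding g_def g'_def by (simp add: algebra_simps)
  qed
  have g'_ge: "g' t \<ge> w t {x, l}" if "t \<ge> 0" for t
    using drift_nonneg[OF deg(2) that] by (simp add: g'_def)
  have "\<exists>s\<ge>0. g s > 0"
  proof (rule ccontr)
    assume "\<not> ?thesis"
    then have neg: "g s \<le> 0" if "s \<ge> 0" for s using that by force
    let ?m = "w 0 {x, y}"
    have m: "?m > 0" using pos[OF _ edge] by simp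
    \<comment> \<open>At speed at least \<open>?m\<close>, the gain up to time \<open>T\<close> is
      at least \<open>?m * T = \<bar>g 0\<bar> + ?m\<close>, enough to make \<open>g T\<close>
      positive.\<close>
    define T where "T = \<bar>g 0\<bar> / ?m + 1"
    have T: "T > 0" using m by (simp add: T_def add_nonneg_pos)
    obtain \<xi> where \<xi>: "0 < \<xi>" "g T - g 0 = g' \<xi> * (T - 0)"
      using half_line_mvt[OF g order_refl T] by metis
    have "?m \<le> w \<xi> {x, y}" using \<xi>(1) by (intro internal_weight_mono) auto
    also have "\<dots> \<le> g' \<xi>" using neg[of \<xi>] g'_ge[of \<xi>] \<xi>(1) by (simp add: g_def)
    finally have "?m * T \<le> g' \<xi> * T" using T by (intro mult_right_mono) auto
    moreover have "?m * T = \<bar>g 0\<bar> + ?m" using m by (simp add: T_def field_simps)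
    ultimately have "g T > 0" using \<xi>(2) m by simp
    then show False using neg[of T] T by simp
  qed
  then obtain s where s: "s \<ge> 0" "g s > 0" by blast
  show ?thesis
    using eventually_ge_at_top[of s]
  proof eventually_elim
    case (elim t)
    \<comment> \<open>Once positive, \<open>g\<close> stays positive, because its derivative is at
      least the positive leaf weight.\<close>
    have "g s \<le> g t"
    proof (rule half_line_mono[OF g _ s(1) elim])
      show "g' r \<ge> 0" if "r \<ge> 0" for r
        using g'_ge[OF that] pos[OF that leaf(1)] by linarith
    qed
    then show ?case using s(2) by (simp add: g_def)
  qed
qed

end

end

theorem proposition1:
  fixes V :: "'a set" and E :: "'a set set" and w :: "real \<Rightarrow> 'a set \<Rightarrow> real" and x y :: 'a
  assumes "is_tree V E"
    and "\<not> is_path_graph V E"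
    and "\<not> is_star_graph V E"
    and "ricci_flow V E w"
    and "internal_edge E {x, y}"
  shows "(\<exists>L::ereal. 0 < L \<and> ((\<lambda>t. ereal (w t {x, y})) \<longlongrightarrow> L) at_top) \<and>
         (\<forall>l::real. ((\<lambda>t. w t {x, y}) \<longlongrightarrow> l) at_top \<longrightarrow>
            ((\<lambda>t. curvature V E (w t) x y) \<longlongrightarrow> 0) at_top) \<and>
         (\<forall>u e. u \<in> {x, y} \<and> leaf_edge E e \<and> u \<in> e \<longrightarrow>
            (\<forall>\<^sub>F t in at_top. w t e < w t {x, y}))"
proof -
  interpret tree_flow V E w using assms by unfold_locales
  have edge: "{x, y} \<in> E" "{y, x} \<in> E"
    and "deg E x \<noteq> 1" "deg E y \<noteq> 1"
    using assms(5) by (auto simp: internal_edge_def leaf_edge_def insert_commute)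
  then have deg: "deg E x \<ge> 2" "deg E y \<ge> 2"
    using deg_pos[OF edge(1)] deg_pos[OF edge(2)] by linarith+
  have leaf: "\<forall>\<^sub>F t in at_top. w t e < w t {x, y}"
    if prems: "u \<in> {x, y}" "leaf_edge E e" "u \<in> e" for u e
  proof -
    \<comment> \<open>As an end of the internal edge, \<open>u\<close> is not the leaf of
      \<open>e\<close>, so \<open>e\<close> joins \<open>u\<close> to its leaf
      \<open>l\<close>.\<close>
    have "deg E u \<noteq> 1" using prems(1) deg by auto
    moreover obtain l where leaf: "e \<in> E" "l \<in> e" "deg E l = 1"
      using prems(2) by (auto simp: leaf_edge_def)
    ultimately have "u \<noteq> l" by metis
    moreover have "card e = 2"
      using leaf(1) assms(1) by (auto simp: is_tree_def simple_graph_def)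
    then obtain a b where "e = {a, b}" by (auto simp: card_2_iff)
    ultimately have e: "e = {u, l}"
      using prems(3) leaf(2) by (auto simp: doubleton_eq_iff)
    note l = e leaf(1)[unfolded e] leaf(3)
    from prems(1) consider "u = x" | "u = y" by blast
    then show ?thesis
    proof cases
      case 1
      then show ?thesis using leaf_weight_less_internal[OF edge(1) deg] l by simp
    next
      case 2
      then show ?thesis
        using leaf_weight_less_internal[OF edge(2) deg(2,1)] l by (simp add: insert_commute)
    qed
  qed
  show ?thesis
    using internal_weight_limit[OF edge(1) deg] internal_curvature_tendsto_0[OF edge(1) deg] leaf
    by blast
qed

end
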